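(* Let $K\ge 1$ be a finite integer and let $q_0,\dots,q_K$ be positive real constants. Suppose that $q_k\le 1$ for all $k\in\{0,\dots,K\}$. Then the system of equations $$\bar q=\frac{\sum_{k=0}^{K}\gamma^k}{\sum_{k=0}^{K}\frac{\gamma^k}{q_k}},\qquad \gamma=1-e^{-\bar q}$$ in the unknowns $\bar q\in[0,\infty)$ and $\gamma\in[0,1)$ has a unique solution $(\bar q,\gamma)$.
   Context: Here $\bar q$ is the average scaled attempt rate, $\gamma$ is the collision probability, and $q_k$ is the scaled attempt rate in backoff stage $k$. The convention $\gamma^0=1$ is used for all $\gamma$, including $\gamma=0$. "Has a unique solution" means that a solution exists and is unique. *)

theory Defs
  imports Complex_Main
begin

end

theory Submission
  imports Defs
begin

text \<open>
  Write \<open>u\<close> for the average rate, \<open>\<gamma> = 1 - e\<^sup>-\<^sup>u\<close> and \<open>A(\<gamma>) = \<Sum>\<^sub>k \<gamma>\<^sup>k / q\<^sub>k\<close>. As \<open>q\<^sub>k \<le> 1\<close>, the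
  numerator of the first equation is at most \<open>A(\<gamma>)\<close>, so every solution has \<open>u \<le> 1\<close>. Multiplying that
  equation by \<open>1 - \<gamma> = e\<^sup>-\<^sup>u\<close> makes the geometric sum telescope and leaves
  \<open>u e\<^sup>-\<^sup>u A(\<gamma>) + \<gamma>\<^bsup>K+1\<^esup> = 1\<close>. On \<open>[0, 1]\<close> the function \<open>u e\<^sup>-\<^sup>u\<close> is increasing, hence the
  left-hand side is strictly increasing; it is \<open>0\<close> at \<open>u = 0\<close> and at least \<open>1\<close> at \<open>u = 1\<close>.
\<close>

text \<open>The bound \<open>exp x \<ge> 1 + x\<close> at \<open>x = u - v\<close> takes the place
  of a derivative: \<open>v * (1 + (u - v))\<close> exceeds \<open>u\<close> by
  \<open>(v - u) * (1 - v)\<close>, which is nonnegative because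
  \<open>u \<le> v \<le> 1\<close>.\<close>

lemma mult_exp_minus_mono:
  fixes u v :: real
  assumes "0 \<le> u" "u \<le> v" "v \<le> 1"
  shows "u * exp (- u) \<le> v * exp (- v)"
proof -
  have "u \<le> v * (1 + (u - v))"
  proof -
    have "v * (1 + (u - v)) - u = (v - u) * (1 - v)"
      by (simp add: algebra_simps)
    also have "\<dots> \<ge> 0" using assms by simp
    finally show ?thesis by simp
  qed
  also have "\<dots> \<le> v * exp (u - v)"
    using assms exp_ge_add_one_self[of "u - v"] by (intro mult_left_mono) auto
  finally have "u * exp (- u) \<le> v * exp (u - v) * exp (- u)"
    by (intro mult_right_mono) auto
  also have "\<dots> = v * exp (- v)"
    by (simp add: mult.assoc exp_diff exp_minus field_simps)
  finally show ?thesis .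
qed

theorem lemma2:
  fixes K :: nat and q :: "nat \<Rightarrow> real"
  assumes "K \<ge> 1"
    and "\<And>k. k \<in> {0..K} \<Longrightarrow> q k > 0"
    and "\<And>k. k \<in> {0..K} \<Longrightarrow> q k \<le> 1"
  shows "\<exists>!(qbar, \<gamma>) \<in> {0..} \<times> {0..<1 :: real}.
           qbar = (\<Sum>k=0..K. \<gamma> ^ k) / (\<Sum>k=0..K. \<gamma> ^ k / q k) \<and>
           \<gamma> = 1 - exp (- qbar)"
proof -
  define G where "G = (\<lambda>x::real. \<Sum>k=0..K. x ^ k)"
  define A where "A = (\<lambda>x::real. \<Sum>k=0..K. x ^ k / q k)"
  define g where "g = (\<lambda>u::real. 1 - exp (- u))"
  define F where "F = (\<lambda>u. u * exp (- u) * A (g u) + g u ^ Suc K)"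
  have g_range: "0 \<le> g u" "g u < 1" if "0 \<le> u" for u
    using that by (simp_all add: g_def)
  have G_pos: "0 < G x" if "0 \<le> x" for x
  proof -
    \<comment> \<open>The term for \<open>k = 0\<close> alone gives positivity, being 1 even at
      \<open>x = 0\<close>.\<close>
    have "(\<Sum>k\<in>{0::nat}. x ^ k) \<le> G x"
      unfolding G_def using that by (intro sum_mono2) auto
    then show ?thesis by simp
  qed
  have G_le_A: "G x \<le> A x" if "0 \<le> x" for x
    unfolding G_def A_def
  proof (rule sum_mono)
    fix k assume k: "k \<in> {0..K}"
    have "x ^ k * q k \<le> x ^ k * 1"
      using that assms(3)[OF k] by (intro mult_left_mono) auto
    then show "x ^ k \<le> x ^ k / q k"
      using assms(2)[OF k] by (simp add: field_simps)
  qed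
  have A_mono: "A x \<le> A y" if "0 \<le> x" "x \<le> y" for x y
    unfolding A_def using that assms(2)
    by (intro sum_mono divide_right_mono power_mono) (auto intro: less_imp_le)
  have telescope: "exp (- u) * G (g u) = 1 - g u ^ Suc K" for u
    using one_diff_power_eq[of "g u" "Suc K"]
    unfolding G_def g_def atLeast0AtMost lessThan_Suc_atMost by simp
  have sol_iff: "u = G (g u) / A (g u) \<longleftrightarrow> F u = 1" if "0 \<le> u" for u
  proof -
    have "A (g u) > 0"
      using G_pos G_le_A g_range(1)[OF that] by (meson less_le_trans)
    then have "u = G (g u) / A (g u) \<longleftrightarrow> u * A (g u) = G (g u)"
      by (simp add: field_simps)
    also have "\<dots> \<longleftrightarrow> exp (- u) * (u * A (g u)) = exp (- u) * G (g u)"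
      by simp
    also have "\<dots> \<longleftrightarrow> F u = 1"
      unfolding telescope F_def by (simp add: mult.left_commute mult.assoc eq_diff_eq)
    finally show ?thesis .
  qed
  have sol_le_1: "u \<le> 1" if "0 \<le> u" "u = G (g u) / A (g u)" for u
  proof -
    have "G (g u) / A (g u) \<le> 1"
      using G_pos G_le_A g_range(1)[OF that(1)] by (smt (verit) divide_le_eq_1_pos)
    with that(2) show ?thesis by linarith
  qed
  have F_less: "F u < F v" if "0 \<le> u" "u < v" "v \<le> 1" for u v
  proof -
    have g_less: "g u < g v" using that by (simp add: g_def)
    have "0 \<le> A (g u)"
      using G_pos G_le_A g_range(1)[OF that(1)] by (meson less_imp_le order_trans)
    then have "u * exp (- u) * A (g u) \<le> v * exp (- v) * A (g v)"
      using that g_less g_range(1)[OF that(1)]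
      by (intro mult_mono mult_exp_minus_mono A_mono) auto
    \<comment> \<open>Strictness comes from this summand; the products above are compared only
      weakly.\<close>
    moreover have "g u ^ Suc K < g v ^ Suc K"
      using g_less g_range(1)[OF that(1)] by (intro power_strict_mono) auto
    ultimately show ?thesis by (simp add: F_def)
  qed
  have "\<exists>u\<ge>0. u \<le> 1 \<and> F u = 1"
  proof (rule IVT')
    show "F 0 \<le> 1" by (simp add: F_def g_def)
    \<comment> \<open>At \<open>u = 1\<close> the factor \<open>u\<close> in \<open>F\<close> is 1,
      so \<open>F 1\<close> is the right-hand side here with \<open>G\<close> enlarged to
      \<open>A\<close>.\<close>
    have "1 = exp (- 1) * G (g 1) + g 1 ^ Suc K"
      using telescope[of 1] by simp
    also have "\<dots> \<le> F 1"
      using G_le_A[OF g_range(1)[of 1]] by (simp add: F_def)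
    finally show "1 \<le> F 1" .
    show "continuous_on {0..1} F"
      unfolding F_def A_def g_def using assms(2)
      by (intro continuous_intros) (auto simp: less_imp_neq[symmetric])
  qed simp
  then obtain u where u: "0 \<le> u" "u \<le> 1" "F u = 1" by blast
  have uniq: "v = u" if "0 \<le> v" "v = G (g v) / A (g v)" for v
  proof -
    \<comment> \<open>The bound \<open>v \<le> 1\<close> puts \<open>v\<close> into the interval on
      which \<open>F\<close> is known to be injective.\<close>
    have "F v = 1" "v \<le> 1"
      using sol_iff[OF that(1)] sol_le_1[OF that] that(2) by blast+
    then show ?thesis
      using F_less[of u v] F_less[of v u] that(1) u by (cases u v rule: linorder_cases) auto
  qed
  have "\<exists>!(v, x). (v, x) \<in> {0..} \<times> {0..<1} \<and> v = G x / A x \<and> x = g v"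
    (is "Ex1 ?sol")
  proof (rule ex1I[of _ "(u, g u)"])
    show "?sol (u, g u)"
      using u(1) g_range[OF u(1)] iffD2[OF sol_iff[OF u(1)] u(3)]
      by (simp only: mem_Times_iff fst_conv snd_conv atLeast_iff atLeastLessThan_iff case_prod_conv)
  next
    fix p assume sol: "?sol p"
    obtain v x where p: "p = (v, x)" by (cases p)
    have "0 \<le> v" and v: "v = G x / A x" and x: "x = g v"
      using sol unfolding p mem_Times_iff fst_conv snd_conv atLeast_iff case_prod_conv by blast+
    have "v = u"
      using uniq[OF \<open>0 \<le> v\<close> v[unfolded x]] .
    with p x show "p = (u, g u)" by simp
  qed
  then show ?thesis unfolding G_def A_def g_def .
qed

end
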